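(* Let $f:\mathbb{R}^n\to\mathbb{R}\cup\{+\infty\}$ be proper, lower semicontinuous and convex, $A\in\mathbb{R}^{m\times n}$, $b\in\mathbb{R}^m$, and let $X$ be the set of minimizers over $x\in\mathbb{R}^n$ of $f(x)+\frac12\|Ax-b\|^2$. Assume $X\neq\varnothing$ and let $r=b-Ax^\star$ for $x^\star\in X$. Then for every $d\in\mathbb{R}^n$: (i) $f_\infty(d)=\langle A^\top r,d\rangle$ if $d\in\big(\partial f^*(A^\top r)\big)_\infty$, and $f_\infty(d)>\langle A^\top r,d\rangle$ if $d\notin\big(\partial f^*(A^\top r)\big)_\infty$; (ii) $f_\infty(d)=\langle A^\top r,d\rangle\iff d\in\big(\partial f^*(A^\top r)\big)_\infty$.
   Context: $f^*$ is the convex conjugate, $\partial$ the convex subdifferential. $f_\infty(d)=\lim_{t\to+\infty}\frac{f(x+td)-f(x)}{t}=\sup_{t>0}\frac{f(x+td)-f(x)}{t}$ (any $x\in\operatorname{dom}f$) is the recession function of $f$. For a nonempty closed convex set $C$, $C_\infty=\{d: x+td\in C\ \ \forall x\in C,\ \forall t>0\}$ is its recession cone. The vector $Ax^\star$, hence $r$, is the same for all $x^\star\in X$. *)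

theory Defs
  imports "HOL-Analysis.Analysis"
begin

definition effective_domain :: "('a \<Rightarrow> ereal) \<Rightarrow> 'a set" where
  "effective_domain f = {x. f x < \<infinity>}"

definition proper_fun :: "('a \<Rightarrow> ereal) \<Rightarrow> bool" where
  "proper_fun f \<longleftrightarrow> (\<forall>x. f x \<noteq> -\<infinity>) \<and> effective_domain f \<noteq> {}"

definition lsc_fun :: "('a::topological_space \<Rightarrow> ereal) \<Rightarrow> bool" where
  "lsc_fun f \<longleftrightarrow> (\<forall>x. f x \<le> Liminf (at x) f)"

(* The counterpart of convex_on UNIV for extended-real values; note 0 * \<infinity> = 0 in ereal. *)
definition convex_fun :: "('a::real_vector \<Rightarrow> ereal) \<Rightarrow> bool" where
  "convex_fun f \<longleftrightarrow> (\<forall>x y. \<forall>u\<ge>0. \<forall>v\<ge>0. u + v = 1 \<longrightarrow>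
     f (u *\<^sub>R x + v *\<^sub>R y) \<le> ereal u * f x + ereal v * f y)"

definition convex_conjugate :: "('a::real_inner \<Rightarrow> ereal) \<Rightarrow> 'a \<Rightarrow> ereal" where
  "convex_conjugate f y = (SUP x. ereal (y \<bullet> x) - f x)"

definition subdifferential :: "('a::real_inner \<Rightarrow> ereal) \<Rightarrow> 'a \<Rightarrow> 'a set" where
  "subdifferential f x = {v. \<forall>z. f x + ereal (v \<bullet> (z - x)) \<le> f z}"

(* The base point x is an explicit argument: for proper, convex and lower semicontinuous f
   the value is the same for every x in the effective domain, and it is to be used for such x. *)
definition recession_fun ::
    "('a::real_vector \<Rightarrow> ereal) \<Rightarrow> 'a \<Rightarrow> 'a \<Rightarrow> ereal" where
  "recession_fun f x d = Lim at_top (\<lambda>t::real. (f (x + t *\<^sub>R d) - f x) / ereal t)"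

definition recession_cone :: "'a::real_vector set \<Rightarrow> 'a set" where
  "recession_cone C = {d. \<forall>x\<in>C. \<forall>t>0. x + t *\<^sub>R d \<in> C}"

definition ls_minimizers ::
    "(real^'n \<Rightarrow> ereal) \<Rightarrow> real^'n^'m \<Rightarrow> real^'m \<Rightarrow> (real^'n) set" where
  "ls_minimizers f A b =
     {x. is_arg_min (\<lambda>x. f x + ereal (1/2 * (norm (A *v x - b))\<^sup>2)) (\<lambda>x. True) x}"

lemma diff_quotient_mono:
  fixes f :: "'a::real_vector \<Rightarrow> ereal"
  assumes "proper_fun f" "convex_fun f" "x \<in> effective_domain f" "0 < s" "s \<le> t"
  shows "(f (x + s *\<^sub>R d) - f x) / ereal s \<le> (f (x + t *\<^sub>R d) - f x) / ereal t"
proof -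
  define u where "u = s / t"
  have u: "0 \<le> u" "0 \<le> 1 - u" using assms by (auto simp: u_def)
  have "(1 - u) *\<^sub>R x + u *\<^sub>R (x + t *\<^sub>R d) = x + s *\<^sub>R d"
    using assms by (simp add: u_def algebra_simps)
  moreover have "f ((1 - u) *\<^sub>R x + u *\<^sub>R (x + t *\<^sub>R d))
      \<le> ereal (1 - u) * f x + ereal u * f (x + t *\<^sub>R d)"
    using assms(2) u by (simp add: convex_fun_def)
  ultimately have le: "f (x + s *\<^sub>R d) \<le> ereal (1 - u) * f x + ereal u * f (x + t *\<^sub>R d)"
    by simp
  obtain a where a: "f x = ereal a"
    using assms(1,3) by (cases "f x") (auto simp: proper_fun_def effective_domain_def)
  show ?thesis
  proof (cases "f (x + t *\<^sub>R d)")
    case (real q)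
    then obtain p where p: "f (x + s *\<^sub>R d) = ereal p"
      using assms(1) le a by (cases "f (x + s *\<^sub>R d)") (auto simp: proper_fun_def)
    have "p \<le> (1 - u) * a + u * q" using le a real p by simp
    then have "t * p \<le> t * ((1 - u) * a + u * q)" using assms by simp
    also have "\<dots> = (t - s) * a + s * q" using assms by (simp add: u_def field_simps)
    finally have "(p - a) / s \<le> (q - a) / t" using assms by (simp add: field_simps)
    then show ?thesis using a real p assms by simp
  next
    case PInf
    then show ?thesis using a assms by simp
  next
    case MInf
    then show ?thesis using assms(1) by (simp add: proper_fun_def)
  qed
qed

lemma recession_fun_tendsto:
  fixes f :: "'a::real_vector \<Rightarrow> ereal"
  assumes "proper_fun f" "convex_fun f" "x \<in> effective_domain f"
  shows "((\<lambda>t. (f (x + t *\<^sub>R d) - f x) / ereal t) \<longlongrightarrow>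
           (SUP t\<in>{0<..}. (f (x + t *\<^sub>R d) - f x) / ereal t)) at_top"
    (is "(?q \<longlongrightarrow> ?S) at_top")
proof (rule order_tendstoI)
  fix l assume "l < ?S"
  then obtain s where s: "0 < s" "l < ?q s" by (auto simp: less_SUP_iff)
  show "\<forall>\<^sub>F t in at_top. l < ?q t"
    using eventually_ge_at_top[of s]
    by eventually_elim (use s diff_quotient_mono[OF assms s(1)] in \<open>blast intro: less_le_trans\<close>)
next
  fix h assume h: "?S < h"
  show "\<forall>\<^sub>F t in at_top. ?q t < h"
    using eventually_gt_at_top[of "0::real"]
  proof eventually_elim
    case (elim t)
    then have "?q t \<le> ?S" by (intro SUP_upper) auto
    then show ?case using h by (rule le_less_trans)
  qed
qed

lemma recession_fun_eq_SUP:
  fixes f :: "'a::real_vector \<Rightarrow> ereal"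
  assumes "proper_fun f" "convex_fun f" "x \<in> effective_domain f"
  shows "recession_fun f x d = (SUP t\<in>{0<..}. (f (x + t *\<^sub>R d) - f x) / ereal t)"
  unfolding recession_fun_def
  by (rule tendsto_Lim[OF _ recession_fun_tendsto[OF assms]]) simp

end

theory Submission
  imports Defs
begin

text \<open>Write \<open>v = A\<^sup>T r\<close>.  Optimality of \<open>xstar\<close> means that \<open>v\<close> is a subgradient of \<open>f\<close> at \<open>xstar\<close>, so the
  affine function \<open>l w = f xstar + v \<bullet> (w - xstar)\<close> lies below \<open>f\<close> and touches it at \<open>xstar\<close>.  By
  Fenchel--Moreau duality, \<open>\<partial>f\<^sup>*(v)\<close> is the whole contact set \<open>{w. f w \<le> l w}\<close>
  (\<open>subdifferential_conjugate_eq_contact_set\<close>).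

  Everything else takes place in the epigraph of \<open>f\<close>, which is closed and convex.  A closed
  convex set that contains one ray in direction \<open>p\<close> has \<open>p\<close> as a recession direction
  (\<open>recession_cone_if_ray\<close>), so a single base point decides membership in a recession cone.
  From the base point \<open>x0\<close> this gives \<open>f\<^sub>\<infinity>(d) \<le> \<mu>\<close> iff \<open>(d, \<mu>)\<close> is a recession direction of the
  epigraph.  The contact set is the set of points \<open>w\<close> whose lift \<open>(w, l w)\<close> is in the epigraph, and
  \<open>l\<close> has slope \<open>v \<bullet> d\<close> along \<open>d\<close>; from the base point \<open>xstar\<close> it follows that \<open>d\<close> is a recession
  direction of the contact set iff \<open>(d, v \<bullet> d)\<close> is one of the epigraph.  Hence
  \<open>f\<^sub>\<infinity>(d) \<le> v \<bullet> d\<close> characterises the recession cone of \<open>\<partial>f\<^sup>*(v)\<close>.  Since \<open>l\<close> is a minorant of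
  \<open>f\<close>, no \<open>(d, m)\<close> with \<open>m < v \<bullet> d\<close> can be a recession direction of the epigraph, so
  \<open>f\<^sub>\<infinity>(d) \<ge> v \<bullet> d\<close> always holds, and the dichotomy is complete.\<close>

section \<open>Epigraphs\<close>

definition ereal_epigraph :: "('a \<Rightarrow> ereal) \<Rightarrow> ('a \<times> real) set" where
  "ereal_epigraph f = {(x, y). f x \<le> ereal y}"

lemma mem_ereal_epigraph [simp]: "(x, y) \<in> ereal_epigraph f \<longleftrightarrow> f x \<le> ereal y"
  by (simp add: ereal_epigraph_def)

lemma convex_ereal_epigraph:
  assumes "convex_fun f"
  shows "convex (ereal_epigraph f)"
proof (rule convexI, clarsimp)
  fix x y :: 'a and p q u v :: real
  assume *: "f x \<le> ereal p" "f y \<le> ereal q" "0 \<le> u" "0 \<le> v" "u + v = 1"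
  then have "f (u *\<^sub>R x + v *\<^sub>R y) \<le> ereal u * f x + ereal v * f y"
    using assms by (simp add: convex_fun_def)
  also have "\<dots> \<le> ereal u * ereal p + ereal v * ereal q"
    using * by (intro add_mono ereal_mult_left_mono) auto
  finally show "f (u *\<^sub>R x + v *\<^sub>R y) \<le> ereal (u * p + v * q)"
    by simp
qed

lemma closed_ereal_epigraph:
  fixes f :: "'a::metric_space \<Rightarrow> ereal"
  assumes "lsc_fun f"
  shows "closed (ereal_epigraph f)"
  unfolding closed_sequential_limits
proof (intro allI impI, elim conjE)
  fix s :: "nat \<Rightarrow> 'a \<times> real" and l
  assume s: "\<forall>n. s n \<in> ereal_epigraph f" and lim: "s \<longlonglongrightarrow> l"
  have le: "f (fst (s n)) \<le> ereal (snd (s n))" for n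
    using s by (metis mem_ereal_epigraph prod.collapse)
  have "f (fst l) \<le> ereal (snd l)"
  proof (rule dense_le)
    fix c assume c: "c < f (fst l)"
    have "c < Liminf (at (fst l)) f"
      using assms c by (auto simp: lsc_fun_def intro: less_le_trans)
    then have "\<forall>\<^sub>F x in at (fst l). c < f x"
      by (rule less_LiminfD)
    \<comment> \<open>The punctured neighbourhood is filled in at its centre by the choice of \<open>c\<close>.\<close>
    then have "\<forall>\<^sub>F x in nhds (fst l). c < f x"
      using c by (auto simp: eventually_at_filter elim: eventually_mono)
    then have "\<forall>\<^sub>F n in sequentially. c < f (fst (s n))"
      using tendsto_fst[OF lim] by (auto simp: filterlim_iff)
    then have "\<forall>\<^sub>F n in sequentially. c \<le> ereal (snd (s n))"
      by eventually_elim (use le in \<open>blast intro: less_imp_le less_le_trans\<close>)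
    then show "c \<le> ereal (snd l)"
      using tendsto_snd[OF lim] by (intro tendsto_lowerbound[of "\<lambda>n. ereal (snd (s n))"]) auto
  qed
  then show "l \<in> ereal_epigraph f"
    by (metis mem_ereal_epigraph prod.collapse)
qed

section \<open>Recession directions\<close>

text \<open>The point \<open>y + t d\<close> is the limit of points on the segments that join \<open>y\<close> to ever more
  distant points of the given ray.\<close>

lemma recession_cone_if_ray:
  fixes C :: "'a::real_normed_vector set"
  assumes "closed C" "convex C" and ray: "\<And>s. s > 0 \<Longrightarrow> x + s *\<^sub>R d \<in> C"
  shows "d \<in> recession_cone C"
  unfolding recession_cone_def
proof (intro CollectI ballI allI impI)
  fix y and t :: real
  assume y: "y \<in> C" and t: "t > 0"
  define e where "e n = inverse (real (Suc n))" for n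
  have e: "0 < e n" "e n \<le> 1" for n
    by (auto simp: e_def field_simps)
  have "(1 - e n) *\<^sub>R y + e n *\<^sub>R (x + (t / e n) *\<^sub>R d) \<in> C" for n
    using e[of n] t by (intro convexD[OF assms(2) y ray]) auto
  moreover have "(1 - e n) *\<^sub>R y + e n *\<^sub>R (x + (t / e n) *\<^sub>R d)
      = (1 - e n) *\<^sub>R y + e n *\<^sub>R x + t *\<^sub>R d" for n
    using e(1)[of n] by (simp add: algebra_simps)
  ultimately have "(1 - e n) *\<^sub>R y + e n *\<^sub>R x + t *\<^sub>R d \<in> C" for n
    by simp
  moreover have "(\<lambda>n. (1 - e n) *\<^sub>R y + e n *\<^sub>R x + t *\<^sub>R d) \<longlonglongrightarrow> (1 - 0) *\<^sub>R y + 0 *\<^sub>R x + t *\<^sub>R d"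
    unfolding e_def by (intro tendsto_intros LIMSEQ_inverse_real_of_nat)
  ultimately show "y + t *\<^sub>R d \<in> C"
    using closed_sequentially[OF assms(1)] by fastforce
qed

text \<open>The supremum of the difference quotients is at most \<open>m\<close> exactly when the ray from
  \<open>(x, f x)\<close> in direction \<open>(d, m)\<close> stays in the epigraph.\<close>

lemma recession_fun_le_iff:
  fixes f :: "'a::real_normed_vector \<Rightarrow> ereal"
  assumes "proper_fun f" "lsc_fun f" "convex_fun f" "x \<in> effective_domain f"
  shows "recession_fun f x d \<le> ereal m \<longleftrightarrow> (d, m) \<in> recession_cone (ereal_epigraph f)"
proof -
  obtain a where a: "f x = ereal a"
    using assms(1,4) by (cases "f x") (auto simp: proper_fun_def effective_domain_def)
  have quotient: "(f (x + t *\<^sub>R d) - f x) / ereal t \<le> ereal m \<longleftrightarrow>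
      (x, a) + t *\<^sub>R (d, m) \<in> ereal_epigraph f" if "t > 0" for t
    using that assms(1) a
    by (cases "f (x + t *\<^sub>R d)") (auto simp: proper_fun_def field_simps)
  have "recession_fun f x d \<le> ereal m \<longleftrightarrow>
      (\<forall>t>0. (x, a) + t *\<^sub>R (d, m) \<in> ereal_epigraph f)"
    using quotient by (auto simp: recession_fun_eq_SUP[OF assms(1,3,4)] SUP_le_iff)
  also have "\<dots> \<longleftrightarrow> (d, m) \<in> recession_cone (ereal_epigraph f)"
  proof
    assume "\<forall>t>0. (x, a) + t *\<^sub>R (d, m) \<in> ereal_epigraph f"
    then show "(d, m) \<in> recession_cone (ereal_epigraph f)"
      using recession_cone_if_ray[OF closed_ereal_epigraph[OF assms(2)] convex_ereal_epigraph[OF assms(3)]]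
      by blast
  next
    assume "(d, m) \<in> recession_cone (ereal_epigraph f)"
    moreover have "(x, a) \<in> ereal_epigraph f"
      by (simp add: a)
    ultimately show "\<forall>t>0. (x, a) + t *\<^sub>R (d, m) \<in> ereal_epigraph f"
      unfolding recession_cone_def by blast
  qed
  finally show ?thesis .
qed

section \<open>The subdifferential of the conjugate\<close>

text \<open>The inclusion of \<open>\<partial>f\<^sup>*(v)\<close> in the contact set is Fenchel--Moreau duality.  Let
  \<open>l w = a + v \<bullet> (w - x)\<close> be the minorant of \<open>f\<close> given by the subgradient.  If \<open>w\<close> is not a
  contact point, then \<open>(w, l w)\<close> is strictly separated from the epigraph, and the separating
  hyperplane yields a slope \<open>z\<close> that violates the subgradient inequality for \<open>f\<^sup>*\<close>.  A
  non-vertical hyperplane is itself the graph of a minorant of slope \<open>z\<close>; a vertical one has no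
  slope of its own, but tilting the known minorant \<open>l\<close> along it gives a suitable \<open>z\<close>.\<close>

lemma subdifferential_conjugate_eq_contact_set:
  fixes f :: "'a::euclidean_space \<Rightarrow> ereal"
  assumes "proper_fun f" "lsc_fun f" "convex_fun f"
    and v: "v \<in> subdifferential f x" and a: "f x = ereal a"
  shows "subdifferential (convex_conjugate f) v = {w. f w \<le> ereal (a + v \<bullet> (w - x))}"
proof -
  have minorant: "ereal (a + v \<bullet> (z - x)) \<le> f z" for z
    using v a by (auto simp: subdifferential_def)
  have conj_le: "convex_conjugate f z \<le> ereal k"
    if "\<And>y c. f y \<le> ereal c \<Longrightarrow> z \<bullet> y - c \<le> k" for z k
    unfolding convex_conjugate_def
  proof (rule SUP_least)
    fix y
    show "ereal (z \<bullet> y) - f y \<le> ereal k"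
      using that[of y] assms(1) by (cases "f y") (auto simp: proper_fun_def)
  qed
  have conj_ge: "ereal (z \<bullet> y - c) \<le> convex_conjugate f z" if "f y \<le> ereal c" for z y c
  proof -
    have "ereal (z \<bullet> y - c) \<le> ereal (z \<bullet> y) - f y"
      using that assms(1) by (cases "f y") (auto simp: proper_fun_def)
    also have "\<dots> \<le> convex_conjugate f z"
      unfolding convex_conjugate_def by (rule SUP_upper) simp
    finally show ?thesis .
  qed
  have conj_v: "convex_conjugate f v = ereal (v \<bullet> x - a)"
  proof (rule antisym)
    show "convex_conjugate f v \<le> ereal (v \<bullet> x - a)"
    proof (rule conj_le)
      fix y c assume "f y \<le> ereal c"
      then have "a + v \<bullet> (y - x) \<le> c"
        using minorant[of y] by (metis ereal_less_eq(3) order_trans)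
      then show "v \<bullet> y - c \<le> v \<bullet> x - a"
        by (simp add: inner_diff_right)
    qed
    show "ereal (v \<bullet> x - a) \<le> convex_conjugate f v"
      using conj_ge[of x a v] a by simp
  qed
  show ?thesis
  proof (intro equalityI subsetI)
    fix w assume "w \<in> {w. f w \<le> ereal (a + v \<bullet> (w - x))}"
    then have "ereal (z \<bullet> w - (a + v \<bullet> (w - x))) \<le> convex_conjugate f z" for z
      by (intro conj_ge) simp
    then show "w \<in> subdifferential (convex_conjugate f) v"
      by (simp add: subdifferential_def conj_v inner_diff_right inner_commute algebra_simps)
  next
    fix w assume w: "w \<in> subdifferential (convex_conjugate f) v"
    have sub: "ereal (v \<bullet> x - a + w \<bullet> (z - v)) \<le> convex_conjugate f z" for z
      using w by (simp add: subdifferential_def conj_v)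
    show "w \<in> {w. f w \<le> ereal (a + v \<bullet> (w - x))}"
    proof (rule ccontr)
      assume "w \<notin> {w. f w \<le> ereal (a + v \<bullet> (w - x))}"
      then have "(w, a + v \<bullet> (w - x)) \<notin> ereal_epigraph f"
        by simp
      then obtain n k where
        below: "n \<bullet> (w, a + v \<bullet> (w - x)) < k" and
        above: "\<forall>q\<in>ereal_epigraph f. k < n \<bullet> q"
        using separating_hyperplane_closed_point[OF convex_ereal_epigraph[OF assms(3)]
            closed_ereal_epigraph[OF assms(2)]] by blast
      obtain p \<alpha> where n: "n = (p, \<alpha>)"
        by (cases n)
      have below': "p \<bullet> w + \<alpha> * (a + v \<bullet> (w - x)) < k"
        using below by (simp add: n)
      have above': "k < p \<bullet> y + \<alpha> * c" if "f y \<le> ereal c" for y c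
        using above that by (auto simp: n dest!: bspec[of _ _ "(y, c)"])
      \<comment> \<open>The epigraph is unbounded upwards, so the normal cannot point downwards.\<close>
      have "0 \<le> \<alpha>"
      proof (rule ccontr)
        assume "\<not> 0 \<le> \<alpha>"
        then have neg: "\<alpha> < 0" by simp
        define c where "c = max a ((k - p \<bullet> x) / \<alpha>)"
        have "k < p \<bullet> x + \<alpha> * c"
          by (rule above') (simp add: a c_def)
        moreover have "\<alpha> * c \<le> \<alpha> * ((k - p \<bullet> x) / \<alpha>)"
          using neg by (intro mult_left_mono_neg) (auto simp: c_def)
        ultimately show False
          using neg by simp
      qed
      then consider "\<alpha> = 0" | "0 < \<alpha>"
        by linarith
      then show False
      proof cases
        case 1
        \<comment> \<open>The vertical case: adding the separation inequality \<open>p \<bullet> y > k\<close> to \<open>f y \<ge> l y\<close>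
          bounds the conjugate at \<open>v - p\<close>.\<close>
        have "convex_conjugate f (v - p) \<le> ereal (v \<bullet> x - a - k)"
        proof (rule conj_le)
          fix y c assume yc: "f y \<le> ereal c"
          then have "a + v \<bullet> (y - x) \<le> c"
            using minorant[of y] by (metis ereal_less_eq(3) order_trans)
          then show "(v - p) \<bullet> y - c \<le> v \<bullet> x - a - k"
            using above'[OF yc] 1 by (simp add: inner_diff_right inner_diff_left)
        qed
        with sub[of "v - p"] have "v \<bullet> x - a + w \<bullet> (- p) \<le> v \<bullet> x - a - k"
          by (metis (no_types, lifting) add_diff_cancel_left' diff_conv_add_uminus ereal_less_eq(3) order_trans)
        then show False
          using below' 1 by (simp add: inner_commute)
      next
        case 2
        define z where "z = - (p /\<^sub>R \<alpha>)"
        have z: "z \<bullet> y = - (p \<bullet> y) / \<alpha>" for y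
          using 2 by (simp add: z_def field_simps)
        have "convex_conjugate f z \<le> ereal (- k / \<alpha>)"
        proof (rule conj_le)
          fix y c assume "f y \<le> ereal c"
          from above'[OF this] have "(z \<bullet> y - c) * \<alpha> \<le> - k"
            using 2 by (simp add: z algebra_simps)
          then show "z \<bullet> y - c \<le> - k / \<alpha>"
            by (simp only: pos_le_divide_eq[OF 2])
        qed
        with sub[of z] have "v \<bullet> x - a + w \<bullet> (z - v) \<le> - k / \<alpha>"
          by (metis ereal_less_eq(3) order_trans)
        then have "v \<bullet> x - a - p \<bullet> w / \<alpha> - v \<bullet> w \<le> - k / \<alpha>"
          using z[of w] by (simp add: inner_diff_right inner_commute)
        then have "\<alpha> * (v \<bullet> x - a - p \<bullet> w / \<alpha> - v \<bullet> w) \<le> \<alpha> * (- k / \<alpha>)"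
          using 2 by (intro mult_left_mono) auto
        then show False
          using below' 2 by (simp add: algebra_simps inner_diff_right)
      qed
    qed
  qed
qed

section \<open>Optimality in the least-squares problem\<close>

lemma ls_minimizer_finite:
  assumes "proper_fun f" "x \<in> ls_minimizers f A b"
  obtains a where "f x = ereal a"
proof -
  obtain y where y: "f y < \<infinity>"
    using assms(1) by (auto simp: proper_fun_def effective_domain_def)
  have "\<not> f y + ereal (1/2 * (norm (A *v y - b))\<^sup>2) < f x + ereal (1/2 * (norm (A *v x - b))\<^sup>2)"
    using assms(2) by (simp add: ls_minimizers_def is_arg_min_def)
  then have "f x \<noteq> \<infinity>"
    using y by (cases "f y") auto
  then show ?thesis
    using assms(1) that by (cases "f x") (auto simp: proper_fun_def)
qed

text \<open>Fermat's rule: compare \<open>x\<close> with \<open>x + t (z - x)\<close>.  By convexity the increment of \<open>f\<close> is at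
  most \<open>t (f z - f x)\<close>, and the quadratic term changes by \<open>t\<close> times its directional derivative, up
  to a term of order \<open>t\<^sup>2\<close> that disappears after division by \<open>t\<close>.\<close>

lemma ls_minimizer_subgradient:
  fixes f :: "real^'n \<Rightarrow> ereal" and A :: "real^'n^'m"
  assumes "proper_fun f" "convex_fun f" and x: "x \<in> ls_minimizers f A b"
  shows "transpose A *v (b - A *v x) \<in> subdifferential f x"
  unfolding subdifferential_def
proof (intro CollectI allI)
  fix z
  obtain a where a: "f x = ereal a"
    using ls_minimizer_finite[OF assms(1) x] .
  define g where "g = A *v x - b"
  define h where "h = A *v (z - x)"
  have grad: "(transpose A *v (b - A *v x)) \<bullet> (z - x) = - (g \<bullet> h)"
    by (simp add: g_def h_def dot_lmul_matrix transpose_matrix_vector inner_diff_left)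
  show "f x + ereal ((transpose A *v (b - A *v x)) \<bullet> (z - x)) \<le> f z"
  proof (cases "f z")
    case (real q)
    have bound: "0 \<le> q - a + g \<bullet> h + t / 2 * (norm h)\<^sup>2" if t: "0 < t" "t \<le> 1" for t
    proof -
      let ?y = "(1 - t) *\<^sub>R x + t *\<^sub>R z"
      have "A *v ?y - b = g + t *\<^sub>R h"
        by (simp add: g_def h_def matrix_vector_right_distrib matrix_vector_mult_diff_distrib
            matrix_vector_mult_scaleR algebra_simps)
      then have sq: "(norm (A *v ?y - b))\<^sup>2 = (norm g)\<^sup>2 + 2 * t * (g \<bullet> h) + t\<^sup>2 * (norm h)\<^sup>2"
        unfolding power2_norm_eq_inner
        by (simp add: inner_add_left inner_add_right inner_commute[of h g] power2_eq_square algebra_simps)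
      have "f ?y \<le> ereal (1 - t) * f x + ereal t * f z"
        using assms(2) t unfolding convex_fun_def by auto
      then have fy: "f ?y \<le> ereal ((1 - t) * a + t * q)"
        by (simp add: a real)
      have "f x + ereal (1/2 * (norm (A *v x - b))\<^sup>2) \<le> f ?y + ereal (1/2 * (norm (A *v ?y - b))\<^sup>2)"
        using x by (simp add: ls_minimizers_def is_arg_min_def not_less)
      also have "\<dots> \<le> ereal ((1 - t) * a + t * q) + ereal (1/2 * (norm (A *v ?y - b))\<^sup>2)"
        using fy by (rule add_right_mono)
      finally have "a + 1/2 * (norm g)\<^sup>2 \<le> (1 - t) * a + t * q + 1/2 * (norm (A *v ?y - b))\<^sup>2"
        by (simp add: a g_def)
      then have "0 \<le> t * (q - a + g \<bullet> h + t / 2 * (norm h)\<^sup>2)"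
        unfolding sq by (simp add: algebra_simps power2_eq_square)
      then show ?thesis
        using t by (simp add: zero_le_mult_iff)
    qed
    have "((\<lambda>t. q - a + g \<bullet> h + t / 2 * (norm h)\<^sup>2) \<longlongrightarrow> q - a + g \<bullet> h + 0 / 2 * (norm h)\<^sup>2) (at_right 0)"
      by (intro tendsto_intros) simp
    moreover have "\<forall>\<^sub>F t in at_right 0. 0 \<le> q - a + g \<bullet> h + t / 2 * (norm h)\<^sup>2"
      by (rule eventually_mono[OF eventually_at_right_real[of 0 1]]) (use bound in \<open>auto simp del: times_divide_eq_left\<close>)
    ultimately have "0 \<le> q - a + g \<bullet> h + 0 / 2 * (norm h)\<^sup>2"
      by (rule tendsto_lowerbound) simp
    then show ?thesis
      unfolding grad by (simp add: a real)
  next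
    case MInf
    then show ?thesis
      using assms(1) by (simp add: proper_fun_def)
  qed simp
qed

section \<open>Recession directions of the contact set\<close>

text \<open>The forward direction needs the ray from the contact point \<open>x\<close> only; closedness and
  convexity of the epigraph carry it to all other base points.\<close>

lemma recession_cone_contact_set:
  fixes f :: "'a::real_inner \<Rightarrow> ereal"
  assumes "lsc_fun f" "convex_fun f" and a: "f x = ereal a"
  shows "d \<in> recession_cone {w. f w \<le> ereal (a + v \<bullet> (w - x))} \<longleftrightarrow>
    (d, v \<bullet> d) \<in> recession_cone (ereal_epigraph f)"
    (is "d \<in> recession_cone ?S \<longleftrightarrow> _")
proof
  assume d: "d \<in> recession_cone ?S"
  have "(x, a) + t *\<^sub>R (d, v \<bullet> d) \<in> ereal_epigraph f" if "t > 0" for t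
  proof -
    have "x \<in> ?S"
      by (simp add: a)
    then have "x + t *\<^sub>R d \<in> ?S"
      using d that unfolding recession_cone_def by blast
    then show ?thesis
      by simp
  qed
  then show "(d, v \<bullet> d) \<in> recession_cone (ereal_epigraph f)"
    by (rule recession_cone_if_ray[OF closed_ereal_epigraph[OF assms(1)]
          convex_ereal_epigraph[OF assms(2)]])
next
  assume d: "(d, v \<bullet> d) \<in> recession_cone (ereal_epigraph f)"
  show "d \<in> recession_cone ?S"
    unfolding recession_cone_def
  proof (intro CollectI ballI allI impI)
    fix w and t :: real
    assume "w \<in> ?S" "t > 0"
    then have "(w, a + v \<bullet> (w - x)) + t *\<^sub>R (d, v \<bullet> d) \<in> ereal_epigraph f"
      using d unfolding recession_cone_def by (auto dest!: bspec[of _ _ "(w, a + v \<bullet> (w - x))"])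
    then show "f (w + t *\<^sub>R d) \<le> ereal (a + v \<bullet> (w + t *\<^sub>R d - x))"
      by (simp add: inner_diff_right inner_add_right algebra_simps)
  qed
qed

lemma recession_slope_ge_subgradient:
  fixes f :: "'a::real_inner \<Rightarrow> ereal"
  assumes "v \<in> subdifferential f x" and a: "f x = ereal a"
    and "(d, m) \<in> recession_cone (ereal_epigraph f)"
  shows "v \<bullet> d \<le> m"
proof -
  have "(x, a) \<in> ereal_epigraph f"
    by (simp add: a)
  then have "(x, a) + 1 *\<^sub>R (d, m) \<in> ereal_epigraph f"
    using assms(3) unfolding recession_cone_def by (blast intro: zero_less_one)
  then have "f (x + d) \<le> ereal (a + m)"
    by simp
  moreover have "ereal (a + v \<bullet> d) \<le> f (x + d)"
    using assms(1) a by (auto simp: subdifferential_def dest: spec[of _ "x + d"])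
  ultimately have "ereal (a + v \<bullet> d) \<le> ereal (a + m)"
    by (rule order_trans[rotated])
  then show ?thesis
    by simp
qed

theorem lemma2p15:
  fixes f :: "real^'n \<Rightarrow> ereal"
    and A :: "real^'n^'m"
    and b r :: "real^'m"
    and xstar x0 d :: "real^'n"
  assumes "proper_fun f" and "lsc_fun f" and "convex_fun f"
    and "xstar \<in> ls_minimizers f A b"
    and "r = b - A *v xstar"
    and "x0 \<in> effective_domain f"
  shows "((d \<in> recession_cone (subdifferential (convex_conjugate f) (transpose A *v r)) \<longrightarrow>
             recession_fun f x0 d = ereal ((transpose A *v r) \<bullet> d)) \<and>
          (d \<notin> recession_cone (subdifferential (convex_conjugate f) (transpose A *v r)) \<longrightarrow>
             recession_fun f x0 d > ereal ((transpose A *v r) \<bullet> d))) \<and>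
         (recession_fun f x0 d = ereal ((transpose A *v r) \<bullet> d) \<longleftrightarrow>
            d \<in> recession_cone (subdifferential (convex_conjugate f) (transpose A *v r)))"
proof -
  define v where "v = transpose A *v r"
  let ?F = "recession_fun f x0 d"
  let ?S = "subdifferential (convex_conjugate f) v"
  obtain a where a: "f xstar = ereal a"
    using ls_minimizer_finite[OF assms(1,4)] .
  have v: "v \<in> subdifferential f xstar"
    using ls_minimizer_subgradient[OF assms(1,3,4)] by (simp add: v_def assms(5))
  note F_le_iff = recession_fun_le_iff[OF assms(1-3,6)]
  have le_iff: "?F \<le> ereal (v \<bullet> d) \<longleftrightarrow> d \<in> recession_cone ?S"
    unfolding F_le_iff subdifferential_conjugate_eq_contact_set[OF assms(1-3) v a]
    by (rule recession_cone_contact_set[OF assms(2,3) a, symmetric])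
  have ge: "ereal (v \<bullet> d) \<le> ?F"
  proof (rule ccontr)
    assume "\<not> ereal (v \<bullet> d) \<le> ?F"
    then obtain m where m: "?F < ereal m" "ereal m < ereal (v \<bullet> d)"
      using ereal_dense2[of ?F "ereal (v \<bullet> d)"] by (auto simp: not_le)
    then have "(d, m) \<in> recession_cone (ereal_epigraph f)"
      using F_le_iff[of d m] by (simp add: less_imp_le)
    then show False
      using recession_slope_ge_subgradient[OF v a] m(2) by fastforce
  qed
  show ?thesis
    unfolding v_def[symmetric] using le_iff ge by (auto simp: not_le)
qed

end
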